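(* For every integer $n \ge 1$, the polynomial $f_n(\lambda) = \det\big((\lambda-1)D_n + A_n\big)$ is given by $$f_n(\lambda) = n^{2^n}\prod_{k=0}^{n}\left(\lambda - \frac{2k}{n}\right)^{\binom{n}{k}},$$ where $A_n$ is the adjacency matrix and $D_n = nI_{2^n}$ is the diagonal degree matrix of the $n$-cube $\Gamma_n$.
   Context: For $n\ge 1$, let $G_n = \mathbb{Z}_2^n$ (with $\mathbb{Z}_2=\mathbb{Z}/2\mathbb{Z}$) and $S_n = \{(x_1,\dots,x_n)\in G_n : \text{exactly one } x_i \text{ equals } 1\}$. The $n$-cube $\Gamma_n = \mathrm{Cay}(G_n,S_n)$ is the simple undirected graph with vertex set $G_n$ in which $g$ and $g'$ are adjacent iff $g' = g+s$ for some $s\in S_n$; it has $2^n$ vertices and is $n$-regular. The vertices are listed in lexicographical order. $A_n$ is the corresponding $2^n\times 2^n$ adjacency matrix (entry $1$ if the two vertices are adjacent and $0$ otherwise), $I_{2^n}$ is the identity matrix of order $2^n$, and $D_n = nI_{2^n}$ is the diagonal degree matrix. The normalized Laplacian matrix of $\Gamma_n$ is $\mathcal{L}_n = I_{2^n} - D_n^{-1/2}A_nD_n^{-1/2} = I_{2^n} - D_n^{-1}A_n$, and its characteristic polynomial is $g_n(\lambda)=\det(\lambda I_{2^n}-\mathcal{L}_n) = n^{-2^n}f_n(\lambda)$. *)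

theory Defs
  imports
    "Jordan_Normal_Form.Determinant"
    "Graph_Theory.Pair_Digraph"
    "HOL-Library.Z2"
    "HOL-Library.List_Lexorder"
    "HOL-Computational_Algebra.Polynomial"
begin

definition cube_group :: "nat \<Rightarrow> bit vec set" where
  "cube_group n = carrier_vec n"

definition cube_generators :: "nat \<Rightarrow> bit vec set" where
  "cube_generators n = {x \<in> cube_group n. \<exists>!i. i < n \<and> x $ i = 1}"

text \<open>A simple undirected graph is represented, as usual in \<open>Graph_Theory\<close>, by a symmetric
  loop-free digraph without multiple arcs.\<close>

definition cayley_graph :: "'a::plus set \<Rightarrow> 'a set \<Rightarrow> 'a pair_pre_digraph" where
  "cayley_graph G S = \<lparr> pverts = G, parcs = {(g, g'). g \<in> G \<and> g' \<in> G \<and> (\<exists>s\<in>S. g' = g + s)} \<rparr>"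

definition n_cube :: "nat \<Rightarrow> bit vec pair_pre_digraph" where
  "n_cube n = cayley_graph (cube_group n) (cube_generators n)"

text \<open>The type \<open>bit\<close> carries no order; sending \<open>0\<close> and \<open>1\<close> to \<open>False < True\<close> turns the
  lexicographical order on bit strings into the one on \<open>bool list\<close> from \<open>List_Lexorder\<close>.\<close>

definition cube_vertices :: "nat \<Rightarrow> bit vec list" where
  "cube_vertices n =
     sorted_key_list_of_set (\<lambda>x. map (\<lambda>b. b = 1) (list_of_vec x)) (pverts (n_cube n))"

definition adjacency_matrix :: "'a pair_pre_digraph \<Rightarrow> 'a list \<Rightarrow> real mat" where
  "adjacency_matrix G vs =
     mat (length vs) (length vs) (\<lambda>(i, j). if (vs ! i, vs ! j) \<in> parcs G then 1 else 0)"

definition cube_adjacency :: "nat \<Rightarrow> real mat" where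
  "cube_adjacency n = adjacency_matrix (n_cube n) (cube_vertices n)"

definition cube_degree :: "nat \<Rightarrow> real mat" where
  "cube_degree n = real n \<cdot>\<^sub>m 1\<^sub>m (2 ^ n)"

text \<open>The determinant is taken over the ring of real polynomials in \<open>\<lambda>\<close>: \<open>[:-1, 1:]\<close> is
  \<open>\<lambda> - 1\<close>, and the entries of the two real matrices become constant polynomials.\<close>

definition cube_f :: "nat \<Rightarrow> real poly" where
  "cube_f n = det ([:-1, 1:] \<cdot>\<^sub>m map_mat (\<lambda>c. [:c:]) (cube_degree n)
                   + map_mat (\<lambda>c. [:c:]) (cube_adjacency n))"

lemma cube_group_eq_vec_of_list: "cube_group n = vec_of_list ` {xs. set xs \<subseteq> UNIV \<and> length xs = n}"
proof (intro equalityI subsetI)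
  fix x assume "x \<in> cube_group n"
  then have "length (list_of_vec x) = n"
    unfolding cube_group_def by (metis carrier_vecD length_list_of_vec)
  then have "list_of_vec x \<in> {xs. set xs \<subseteq> UNIV \<and> length xs = n}"
    by blast
  then show "x \<in> vec_of_list ` {xs. set xs \<subseteq> UNIV \<and> length xs = n}"
    by (metis imageI vec_list)
next
  fix x assume "x \<in> vec_of_list ` {xs :: bit list. set xs \<subseteq> UNIV \<and> length xs = n}"
  then obtain xs where "x = vec_of_list xs" "length xs = n" by blast
  then show "x \<in> cube_group n"
    unfolding cube_group_def by (metis carrier_vecI dim_vec_of_list)
qed

lemma UNIV_bit: "(UNIV :: bit set) = {0, 1}"
proof -
  have "x = 0 \<or> x = 1" for x :: bit by (cases "x = 0") simp_all
  then show ?thesis by auto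
qed

lemma finite_cube_group: "finite (cube_group n)"
  unfolding cube_group_eq_vec_of_list UNIV_bit
  by (intro finite_imageI finite_lists_length_eq) simp

lemma card_cube_group: "card (cube_group n) = 2 ^ n"
proof -
  have "inj_on (vec_of_list :: bit list \<Rightarrow> _) A" for A
    by (metis inj_on_inverseI list_vec)
  then show ?thesis
    unfolding cube_group_eq_vec_of_list UNIV_bit
    by (simp add: card_image card_lists_length_eq numeral_2_eq_2)
qed

lemma pair_graph_n_cube: "pair_graph (n_cube n)"
proof unfold_locales
  show "finite (pverts (n_cube n))"
    by (simp add: n_cube_def cayley_graph_def finite_cube_group)
  show "finite (parcs (n_cube n))"
    by (rule finite_subset[of _ "cube_group n \<times> cube_group n"])
      (auto simp: n_cube_def cayley_graph_def finite_cube_group)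
  show "fst e \<in> pverts (n_cube n)" "snd e \<in> pverts (n_cube n)" if "e \<in> parcs (n_cube n)" for e
    using that by (auto simp: n_cube_def cayley_graph_def)
  show "fst e \<noteq> snd e" if "e \<in> parcs (n_cube n)" for e
  proof
    assume eq: "fst e = snd e"
    from that eq obtain g s where g: "g \<in> carrier_vec n" and s: "s \<in> cube_generators n"
      and gs: "g = g + s"
      by (auto simp: n_cube_def cayley_graph_def cube_group_def)
    from s obtain i where i: "i < n" "s $ i = 1" "s \<in> carrier_vec n"
      by (auto simp: cube_generators_def cube_group_def)
    have "g $ i = g $ i + 1"
      using arg_cong[OF gs, of "\<lambda>v. v $ i"] i g by simp
    then show False by (cases "g $ i = 0") simp_all
  qed
  show "symmetric (with_proj (n_cube n))"
  proof -
    have "(h, g) \<in> parcs (n_cube n)" if "(g, h) \<in> parcs (n_cube n)" for g h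
    proof -
      from that obtain s where g: "g \<in> carrier_vec n" and h: "h = g + s"
        and s: "s \<in> cube_generators n"
        by (auto simp: n_cube_def cayley_graph_def cube_group_def)
      have sc: "s \<in> carrier_vec n" using s by (simp add: cube_generators_def cube_group_def)
      have "x + y + y = x" for x y :: bit by (cases "x = 0"; cases "y = 0") simp_all
      then have "g = h + s"
        using g sc unfolding h by (intro eq_vecI) (auto simp del: add_bit_eq_xor)
      moreover have "h \<in> carrier_vec n" using g sc h by simp
      ultimately show ?thesis using g s
        unfolding n_cube_def cayley_graph_def cube_group_def by (simp del: add_bit_eq_xor) blast
    qed
    then show ?thesis by (auto simp: symmetric_def sym_def arcs_ends_def arc_to_ends_def)
  qed
qed

lemma (in linorder) sorted_key_list_of_set_inj:
  assumes "inj f" and "finite A"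
  shows "set (sorted_key_list_of_set f A) = A"
    and "sorted_wrt (<) (map f (sorted_key_list_of_set f A))"
    and "length (sorted_key_list_of_set f A) = card A"
    and "distinct (sorted_key_list_of_set f A)"
proof -
  interpret folding_insort_key "(\<le>)" "(<)" UNIV f
    by unfold_locales (rule assms(1))
  show "set (sorted_key_list_of_set f A) = A"
    by (rule set_sorted_key_list_of_set[OF subset_UNIV assms(2)])
  show "sorted_wrt (<) (map f (sorted_key_list_of_set f A))"
    by (rule strict_sorted_key_list_of_set[OF subset_UNIV])
  show "length (sorted_key_list_of_set f A) = card A"
    by (rule length_sorted_key_list_of_set[OF subset_UNIV])
  show "distinct (sorted_key_list_of_set f A)"
    by (rule distinct_if_distinct_map[OF distinct_sorted_key_list_of_set[OF subset_UNIV]])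
qed

lemma cube_vertices:
  "set (cube_vertices n) = cube_group n"
  "distinct (cube_vertices n)"
  "length (cube_vertices n) = 2 ^ n"
  "sorted_wrt (<) (map (\<lambda>x. map (\<lambda>b. b = 1) (list_of_vec x)) (cube_vertices n))"
proof -
  let ?k = "\<lambda>x :: bit vec. map (\<lambda>b. b = 1) (list_of_vec x)"
  have "inj (\<lambda>b :: bit. b = 1)" 
  proof (rule injI)
    show "a = b" if "(a = 1) = (b = 1)" for a b :: bit
      using that by (cases "a = 0"; cases "b = 0") simp_all
  qed
  then have "list_of_vec x = list_of_vec y" if "?k x = ?k y" for x y :: "bit vec"
    using that by (metis inj_map_eq_map)
  then have inj: "inj ?k"
    by (intro injI) (metis vec_list)
  have "cube_vertices n = sorted_key_list_of_set ?k (cube_group n)"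
    by (simp add: cube_vertices_def n_cube_def cayley_graph_def)
  with sorted_key_list_of_set_inj[OF inj finite_cube_group, of n]
  show "set (cube_vertices n) = cube_group n"
    "distinct (cube_vertices n)"
    "length (cube_vertices n) = 2 ^ n"
    "sorted_wrt (<) (map ?k (cube_vertices n))"
    by (simp_all only: card_cube_group)
qed

lemma cube_matrix_carrier:
  "cube_adjacency n \<in> carrier_mat (2 ^ n) (2 ^ n)"
  "cube_degree n \<in> carrier_mat (2 ^ n) (2 ^ n)"
  by (simp_all add: cube_adjacency_def adjacency_matrix_def cube_degree_def cube_vertices)

end

theory Submission
  imports Defs
begin

text \<open>
  The characters of \<open>\<int>\<^sub>2\<^sup>n\<close> diagonalise every Cayley matrix of the group. Identifying vertices with
  subsets of \<open>{..<n}\<close>, the character attached to \<open>Z\<close> has eigenvalue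
  \<open>\<Sum>j<n. \<plusminus>1 = n - 2 |Z|\<close> under \<open>A\<^sub>n\<close>, hence \<open>n (\<lambda> - 2 |Z| / n)\<close> under \<open>(\<lambda> - 1) D\<^sub>n + A\<^sub>n\<close>. The matrix of
  all characters squares to \<open>2\<^sup>n I\<close>, so its determinant can be cancelled, and the determinant is the
  product of these eigenvalues over all \<open>Z\<close>.
\<close>

text \<open>The columns of \<open>H\<close> are eigenvectors, so \<open>A * H = H * D\<close> with
  \<open>D\<close> diagonal. Taking determinants and cancelling \<open>det H\<close> works in any
  integral domain, hence over \<open>real poly\<close>.\<close>

lemma det_eq_prod_eigenvalues:
  fixes A H :: "'a::idom mat"
  assumes A: "A \<in> carrier_mat m m" and H: "H \<in> carrier_mat m m" and "det H \<noteq> 0"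
    and eigen: "\<And>i j. i < m \<Longrightarrow> j < m \<Longrightarrow> (A * H) $$ (i, j) = H $$ (i, j) * d j"
  shows "det A = (\<Prod>j<m. d j)"
proof -
  define D where "D = mat m m (\<lambda>(i, j). if i = j then d i else 0)"
  have D: "D \<in> carrier_mat m m" by (simp add: D_def)
  have "A * H = H * D"
  proof (rule eq_matI)
    fix i j assume "i < dim_row (H * D)" "j < dim_col (H * D)"
    then have ij: "i < m" "j < m" using H D by auto
    have "(H * D) $$ (i, j) = (\<Sum>k = 0..<m. H $$ (i, k) * (if k = j then d k else 0))"
      using ij H by (simp add: D_def scalar_prod_def)
    also have "\<dots> = (\<Sum>k = 0..<m. if k = j then H $$ (i, k) * d k else 0)"
      by (rule sum.cong) auto
    also have "\<dots> = H $$ (i, j) * d j"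
      using ij by simp
    finally show "(A * H) $$ (i, j) = (H * D) $$ (i, j)"
      using eigen[OF ij] by simp
  qed (use A H D in auto)
  then have "det A * det H = det H * det D"
    using det_mult[OF A H] det_mult[OF H D] by metis
  then have "det A = det D"
    using \<open>det H \<noteq> 0\<close> by (metis mult.commute mult_right_cancel)
  also have "\<dots> = prod_list (diag_mat D)"
    by (rule det_upper_triangular[OF _ D]) (auto simp: D_def)
  also have "\<dots> = (\<Prod>j<m. d j)"
    by (simp add: prod_list_diag_prod D_def atLeast0LessThan)
  finally show ?thesis .
qed

section \<open>Characters of the cube group, indexed by subsets\<close>

definition cube_sign :: "nat set \<Rightarrow> nat \<Rightarrow> 'a::comm_ring_1" where
  "cube_sign X i = (if i \<in> X then -1 else 1)"

text \<open>For finite \<open>Y\<close> this is (-1)^|X \<inter> Y|, the value at \<open>Y\<close>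
  of the character attached to \<open>X\<close>. The product form makes it factor over
  coordinates.\<close>

definition cube_char :: "nat set \<Rightarrow> nat set \<Rightarrow> 'a::comm_ring_1" where
  "cube_char X Y = (\<Prod>i\<in>Y. cube_sign X i)"

lemma cube_char_commute:
  assumes "finite X" "finite Y"
  shows "cube_char X Y = cube_char Y X"
proof -
  have "cube_char X Y = (-1) ^ card (X \<inter> Y)" if "finite Y" for X Y
  proof -
    have "cube_char X Y = (\<Prod>i\<in>X \<inter> Y. -1)"
      unfolding cube_char_def cube_sign_def
      using that by (subst Int_commute, subst prod.inter_restrict) auto
    then show ?thesis by simp
  qed
  then show ?thesis using assms by (metis Int_commute)
qed

text \<open>Symmetric difference is the group addition on subsets, so this is multiplicativity of
  the character of \<open>Z\<close> along a generator.\<close>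

lemma cube_char_flip:
  assumes "finite X"
  shows "cube_char Z (sym_diff X {j}) = cube_char Z X * cube_sign Z j"
proof (cases "j \<in> X")
  case True
  then have "cube_char Z X = cube_sign Z j * cube_char Z (X - {j})"
    unfolding cube_char_def using assms by (simp add: prod.remove)
  moreover have "sym_diff X {j} = X - {j}" using True by auto
  \<comment> \<open>A sign is its own inverse, so deleting the factor at \<open>j\<close> amounts to
    multiplying by it once more.\<close>
  moreover have "cube_sign Z j * cube_sign Z j = (1 :: 'a)" by (simp add: cube_sign_def)
  ultimately show ?thesis by (metis mult.assoc mult.commute mult_1)
next
  case False
  then have "sym_diff X {j} = insert j X" by auto
  then show ?thesis
    using False assms by (simp add: cube_char_def mult.commute)
qed

lemma sum_cube_sign:
  assumes "Z \<subseteq> {..<n}"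
  shows "(\<Sum>j<n. cube_sign Z j) = (of_nat n - 2 * of_nat (card Z) :: 'a::comm_ring_1)"
proof -
  have "(\<Sum>j<n. cube_sign Z j) = (\<Sum>j<n. 1 - 2 * (if j \<in> Z then 1 else 0 :: 'a))"
    by (rule sum.cong) (auto simp: cube_sign_def)
  also have "\<dots> = of_nat n - 2 * (\<Sum>j<n. if j \<in> Z then 1 else 0)"
    by (simp add: sum_subtractf sum_distrib_left)
  also have "(\<Sum>j<n. if j \<in> Z then 1 else 0) = (\<Sum>j\<in>{..<n} \<inter> Z. 1 :: 'a)"
    by (rule sum.inter_restrict[symmetric]) simp
  also have "{..<n} \<inter> Z = Z" using assms by auto
  finally show ?thesis by simp
qed

text \<open>Summing a product of coordinate factors over all subsets gives a product over
  coordinates: a factor is 1 + 1 = 2 where \<open>X\<close> and \<open>Z\<close> agree and -1 + 1 =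
  0 where they differ.\<close>

lemma cube_char_orthogonal:
  assumes "X \<subseteq> {..<n}" "Z \<subseteq> {..<n}"
  shows "(\<Sum>Y\<in>Pow {..<n}. cube_char X Y * cube_char Y Z) =
    (if X = Z then 2 ^ n else (0 :: 'a::comm_ring_1))"
proof -
  have fin: "finite Y" if "Y \<subseteq> {..<n}" for Y
    using that finite_subset by blast
  have "(\<Sum>Y\<in>Pow {..<n}. cube_char X Y * cube_char Y Z) =
      (\<Sum>Y\<in>Pow {..<n}. (\<Prod>i\<in>Y. cube_sign X i * cube_sign Z i) * (\<Prod>i\<in>{..<n} - Y. 1 :: 'a))"
    using assms fin
    by (intro sum.cong refl) (simp add: cube_char_commute[of _ Z], simp add: cube_char_def prod.distrib)
  also have "\<dots> = (\<Prod>i<n. cube_sign X i * cube_sign Z i + 1)"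
    by (rule prod_add[symmetric]) simp
  also have "\<dots> = (if X = Z then 2 ^ n else 0)"
  proof (cases "X = Z")
    case True
    then have "(\<Prod>i<n. cube_sign X i * cube_sign Z i + 1) = (\<Prod>i<n. 2 :: 'a)"
      by (intro prod.cong) (auto simp: cube_sign_def)
    with True show ?thesis by simp
  next
    case False
    then obtain i where "i < n" "i \<in> X \<longleftrightarrow> i \<notin> Z" using assms by blast
    then have "\<exists>i\<in>{..<n}. cube_sign X i * cube_sign Z i + 1 = (0 :: 'a)"
      by (intro bexI[of _ i]) (auto simp: cube_sign_def)
    then have "(\<Prod>i<n. cube_sign X i * cube_sign Z i + 1) = (0 :: 'a)"
      by (intro prod_zero) auto
    with False show ?thesis by simp
  qed
  finally show ?thesis .
qed

section \<open>The cube graph in terms of subsets\<close>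

definition bit_support :: "bit vec \<Rightarrow> nat set" where
  "bit_support x = {i. i < dim_vec x \<and> x $ i = 1}"

lemma bij_betw_bit_support: "bij_betw bit_support (carrier_vec n) (Pow {..<n})"
proof (rule bij_betw_byWitness[where f' = "\<lambda>X. vec n (\<lambda>i. if i \<in> X then 1 else 0)"])
  show "\<forall>x\<in>carrier_vec n. vec n (\<lambda>i. if i \<in> bit_support x then 1 else 0) = x"
    by (auto simp: bit_support_def)
qed (auto simp: bit_support_def split: if_splits)

lemma bit_support_add:
  assumes "x \<in> carrier_vec n" "y \<in> carrier_vec n"
  shows "bit_support (x + y) = sym_diff (bit_support x) (bit_support y)"
proof -
  have "a + b = 1 \<longleftrightarrow> (a = 1) \<noteq> (b = 1)" for a b :: bit
    by (cases a; cases b) auto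
  then show ?thesis
    using assms by (auto simp: bit_support_def simp del: add_bit_eq_xor)
qed

lemma bit_support_cube_generators:
  "bit_support ` cube_generators n = (\<lambda>j. {j}) ` {..<n}"
proof -
  \<comment> \<open>Unique existence is restated as a set being a singleton, which turns the
    definition of a generator into a condition on its support.\<close>
  have ex1: "(\<exists>!i. P i) \<longleftrightarrow> (\<exists>j. {i. P i} = {j})" for P :: "nat \<Rightarrow> bool"
    by (metis (mono_tags, lifting) mem_Collect_eq singletonD singletonI Collect_cong singleton_conv)
  have sub: "bit_support x \<subseteq> {..<n}" if "x \<in> carrier_vec n" for x
    using bij_betw_apply[OF bij_betw_bit_support that] by simp
  have "(\<exists>!i. i < n \<and> x $ i = 1) \<longleftrightarrow> bit_support x \<in> (\<lambda>j. {j}) ` {..<n}"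
    if "x \<in> carrier_vec n" for x
  proof -
    have "(\<exists>!i. i < n \<and> x $ i = 1) \<longleftrightarrow> (\<exists>j. bit_support x = {j})"
      using that by (simp add: ex1 bit_support_def)
    also have "\<dots> \<longleftrightarrow> bit_support x \<in> (\<lambda>j. {j}) ` {..<n}"
      using sub[OF that] by (auto simp: image_iff)
    finally show ?thesis .
  qed
  then have "cube_generators n = {x \<in> carrier_vec n. bit_support x \<in> (\<lambda>j. {j}) ` {..<n}}"
    unfolding cube_generators_def cube_group_def by blast
  then have "bit_support ` cube_generators n = bit_support ` carrier_vec n \<inter> (\<lambda>j. {j}) ` {..<n}"
    by blast
  also have "\<dots> = (\<lambda>j. {j}) ` {..<n}"
    unfolding bij_betw_imp_surj_on[OF bij_betw_bit_support] by blast
  finally show ?thesis .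
qed

text \<open>Supports determine vectors and turn addition into symmetric difference, while generators
  become singletons. Neighbours therefore arise by flipping one coordinate.\<close>

lemma n_cube_adjacent_iff:
  assumes x: "x \<in> carrier_vec n" and y: "y \<in> carrier_vec n"
  shows "(x, y) \<in> parcs (n_cube n) \<longleftrightarrow>
    bit_support y \<in> (\<lambda>j. sym_diff (bit_support x) {j}) ` {..<n}"
proof -
  have gen: "s \<in> carrier_vec n" if "s \<in> cube_generators n" for s
    using that by (simp add: cube_generators_def cube_group_def)
  have "y = x + s \<longleftrightarrow> bit_support y = sym_diff (bit_support x) (bit_support s)"
    if "s \<in> carrier_vec n" for s
    using bij_betw_imp_inj_on[OF bij_betw_bit_support, of n] x y that
    by (metis add_carrier_vec bit_support_add inj_onD)
  then have "(x, y) \<in> parcs (n_cube n) \<longleftrightarrow>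
      bit_support y \<in> sym_diff (bit_support x) ` (bit_support ` cube_generators n)"
    using x y gen by (auto simp: n_cube_def cayley_graph_def cube_group_def image_iff)
  then show ?thesis
    by (simp add: bit_support_cube_generators image_image)
qed

definition cube_subset :: "nat \<Rightarrow> nat \<Rightarrow> nat set" where
  "cube_subset n i = bit_support (cube_vertices n ! i)"

text \<open>Turns sums and products over matrix indices into ones over subsets of
  \<open>{..<n}\<close>.\<close>

lemma bij_betw_cube_subset: "bij_betw (cube_subset n) {..<2 ^ n} (Pow {..<n})"
proof -
  have "bij_betw ((!) (cube_vertices n)) {..<2 ^ n} (carrier_vec n)"
    by (rule bij_betw_nth) (simp_all add: cube_vertices cube_group_def)
  from bij_betw_trans[OF this bij_betw_bit_support] show ?thesis
    by (simp add: cube_subset_def[abs_def] comp_def)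
qed

lemma cube_subset_subset: "i < 2 ^ n \<Longrightarrow> cube_subset n i \<subseteq> {..<n}"
  using bij_betw_apply[OF bij_betw_cube_subset, of i n] by simp

lemma cube_adjacency_index:
  assumes "i < 2 ^ n" "j < 2 ^ n"
  shows "cube_adjacency n $$ (i, j) =
    (if cube_subset n j \<in> (\<lambda>k. sym_diff (cube_subset n i) {k}) ` {..<n} then 1 else 0)"
proof -
  have "cube_vertices n ! i \<in> carrier_vec n" if "i < 2 ^ n" for i
    using that cube_vertices(1,3)[of n] nth_mem by (fastforce simp: cube_group_def)
  then show ?thesis
    using assms n_cube_adjacent_iff
    by (simp add: cube_adjacency_def adjacency_matrix_def cube_vertices cube_subset_def)
qed

section \<open>The character matrix and the eigenvalues\<close>

definition cube_char_mat :: "nat \<Rightarrow> 'a::comm_ring_1 mat" where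
  "cube_char_mat n = mat (2 ^ n) (2 ^ n) (\<lambda>(i, j). cube_char (cube_subset n i) (cube_subset n j))"

lemma cube_char_mat_carrier: "cube_char_mat n \<in> carrier_mat (2 ^ n) (2 ^ n)"
  by (simp add: cube_char_mat_def)

lemma cube_char_mat_square:
  "cube_char_mat n * cube_char_mat n = (2 ^ n \<cdot>\<^sub>m 1\<^sub>m (2 ^ n) :: 'a::comm_ring_1 mat)"
proof (rule eq_matI)
  fix i j assume "i < dim_row (2 ^ n \<cdot>\<^sub>m 1\<^sub>m (2 ^ n) :: 'a mat)" "j < dim_col (2 ^ n \<cdot>\<^sub>m 1\<^sub>m (2 ^ n) :: 'a mat)"
  then have ij: "i < 2 ^ n" "j < 2 ^ n" by auto
  have "(cube_char_mat n * cube_char_mat n :: 'a mat) $$ (i, j) =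
      (\<Sum>k<2 ^ n. cube_char (cube_subset n i) (cube_subset n k) * cube_char (cube_subset n k) (cube_subset n j))"
    using ij by (simp add: cube_char_mat_def scalar_prod_def atLeast0LessThan)
  also have "\<dots> = (\<Sum>Y\<in>Pow {..<n}. cube_char (cube_subset n i) Y * cube_char Y (cube_subset n j))"
    by (rule sum.reindex_bij_betw[OF bij_betw_cube_subset])
  also have "\<dots> = (if cube_subset n i = cube_subset n j then 2 ^ n else 0)"
    using ij by (intro cube_char_orthogonal cube_subset_subset)
  also have "cube_subset n i = cube_subset n j \<longleftrightarrow> i = j"
    using ij bij_betw_imp_inj_on[OF bij_betw_cube_subset] by (auto dest: inj_onD)
  finally show "(cube_char_mat n * cube_char_mat n :: 'a mat) $$ (i, j) = (2 ^ n \<cdot>\<^sub>m 1\<^sub>m (2 ^ n)) $$ (i, j)"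
    using ij by simp
qed (simp_all add: cube_char_mat_def)

text \<open>The square of this determinant is a power of 2, which is nonzero in characteristic
  0.\<close>

lemma det_cube_char_mat_nonzero: "det (cube_char_mat n :: 'a::{idom, ring_char_0} mat) \<noteq> 0"
proof -
  have "det (cube_char_mat n) * det (cube_char_mat n) = det (2 ^ n \<cdot>\<^sub>m 1\<^sub>m (2 ^ n) :: 'a mat)"
    using cube_char_mat_square det_mult[OF cube_char_mat_carrier cube_char_mat_carrier] by metis
  also have "\<dots> \<noteq> 0" by simp
  finally show ?thesis by auto
qed

text \<open>The eigenvector equation for the adjacency matrix: flipping \<open>j\<close> multiplies
  the character of \<open>Z\<close> by its sign at \<open>j\<close>, so the eigenvalue is the sum of
  these signs.\<close>

lemma sum_flips_cube_char:
  assumes "X \<subseteq> {..<n}" "Z \<subseteq> {..<n}"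
  shows "(\<Sum>Y\<in>Pow {..<n}. (if Y \<in> (\<lambda>j. sym_diff X {j}) ` {..<n} then 1 else 0) * cube_char Y Z) =
    (cube_char X Z * (of_nat n - 2 * of_nat (card Z)) :: 'a::comm_ring_1)"
proof -
  let ?flip = "\<lambda>j. sym_diff X {j}"
  have fin: "finite Y" if "Y \<subseteq> {..<n}" for Y
    using that finite_subset by blast
  have sub: "?flip ` {..<n} \<subseteq> Pow {..<n}" using assms by auto
  have inj: "inj_on ?flip {..<n}" by (rule inj_onI) blast
  have "(\<Sum>Y\<in>Pow {..<n}. (if Y \<in> ?flip ` {..<n} then 1 else 0) * cube_char Y Z) =
      (\<Sum>Y\<in>?flip ` {..<n}. cube_char Y Z :: 'a)"
    using sub by (intro sum.mono_neutral_cong_right) auto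
  also have "\<dots> = (\<Sum>j<n. cube_char (?flip j) Z)"
    by (subst sum.reindex[OF inj]) simp
  also have "\<dots> = (\<Sum>j<n. cube_char X Z * cube_sign Z j)"
    using assms fin by (intro sum.cong refl) (simp add: cube_char_commute[of _ Z] cube_char_flip)
  also have "\<dots> = cube_char X Z * (\<Sum>j<n. cube_sign Z j)"
    by (simp add: sum_distrib_left)
  finally show ?thesis using assms by (simp add: sum_cube_sign)
qed

text \<open>Grouping subsets by cardinality produces the binomial exponents.\<close>

lemma prod_Pow_card:
  fixes f :: "nat \<Rightarrow> 'a::comm_monoid_mult"
  assumes "finite A"
  shows "(\<Prod>X\<in>Pow A. f (card X)) = (\<Prod>k = 0..card A. f k ^ (card A choose k))"
proof -
  have "(\<Prod>X\<in>Pow A. f (card X)) = (\<Prod>k = 0..card A. \<Prod>X\<in>{X \<in> Pow A. card X = k}. f (card X))"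
    using assms by (intro prod.group[symmetric]) (auto intro: card_mono)
  also have "\<dots> = (\<Prod>k = 0..card A. f k ^ (card A choose k))"
    using assms by (intro prod.cong) (auto simp: n_subsets)
  finally show ?thesis .
qed

theorem theorem3p4:
  fixes n :: nat
  assumes "n \<ge> 1"
  shows "cube_f n =
    smult (real n ^ (2 ^ n)) (\<Prod>k = 0..n. [:- (2 * real k / real n), 1:] ^ (n choose k))"
proof -
  define M where "M = [:-1, 1:] \<cdot>\<^sub>m map_mat (\<lambda>c. [:c:]) (cube_degree n)
    + map_mat (\<lambda>c. [:c:]) (cube_adjacency n)"
  \<comment> \<open>The eigenvalue of \<open>M\<close> on the character of a
    \<open>k\<close>-element set.\<close>
  define F where "F k = smult (real n) [:- (2 * real k / real n), 1:]" for k
  define S where "S = cube_subset n"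
  define c :: "nat set \<Rightarrow> nat set \<Rightarrow> real poly" where "c = cube_char"
  have M: "M \<in> carrier_mat (2 ^ n) (2 ^ n)"
    using cube_matrix_carrier[of n] by (simp add: M_def)
  \<comment> \<open>Since \<open>n\<close> is nonzero the fraction clears: n \<lambda> - 2k = n
    (\<lambda> - 1) + (n - 2k), the degree part plus the adjacency part.\<close>
  have F: "F k = [:- real n, real n:] + (of_nat n - 2 * of_nat k)" for k
    using assms by (simp add: F_def of_nat_poly numeral_poly)
  have "(M * cube_char_mat n) $$ (i, j) = cube_char_mat n $$ (i, j) * F (card (S j))"
    if ij: "i < 2 ^ n" "j < 2 ^ n" for i j
  proof -
    have "(M * cube_char_mat n) $$ (i, j) =
        (\<Sum>k<2 ^ n. M $$ (i, k) * c (S k) (S j))"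
      using ij M by (simp add: cube_char_mat_def scalar_prod_def atLeast0LessThan S_def c_def)
    \<comment> \<open>Each entry of \<open>M\<close> splits into its diagonal degree term and a 0/1
      adjacency term.\<close>
    also have "\<dots> = (\<Sum>k<2 ^ n. (if i = k then [:- real n, real n:] * c (S k) (S j) else 0)
        + (if S k \<in> (\<lambda>j. sym_diff (S i) {j}) ` {..<n} then 1 else 0) * c (S k) (S j))"
      using ij cube_matrix_carrier[of n]
      by (intro sum.cong refl)
        (auto simp: M_def cube_adjacency_index cube_degree_def S_def algebra_simps one_pCons)
    also have "\<dots> = [:- real n, real n:] * c (S i) (S j) +
        (\<Sum>k<2 ^ n. (if S k \<in> (\<lambda>j. sym_diff (S i) {j}) ` {..<n} then 1 else 0) * c (S k) (S j))"
      using ij by (simp add: sum.distrib)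
    also have "(\<Sum>k<2 ^ n. (if S k \<in> (\<lambda>j. sym_diff (S i) {j}) ` {..<n} then 1 else 0) * c (S k) (S j)) =
        (\<Sum>Y\<in>Pow {..<n}. (if Y \<in> (\<lambda>j. sym_diff (S i) {j}) ` {..<n} then 1 else 0) * c Y (S j))"
      unfolding S_def by (rule sum.reindex_bij_betw[OF bij_betw_cube_subset])
    also have "\<dots> = c (S i) (S j) * (of_nat n - 2 * of_nat (card (S j)))"
      unfolding S_def c_def using ij by (intro sum_flips_cube_char cube_subset_subset)
    also have "[:- real n, real n:] * c (S i) (S j) + \<dots> = c (S i) (S j) * F (card (S j))"
      unfolding F by (simp only: distrib_left mult.commute)
    finally show ?thesis
      using ij by (simp add: cube_char_mat_def S_def c_def)
  qed
  then have "cube_f n = (\<Prod>j<2 ^ n. F (card (S j)))"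
    unfolding cube_f_def M_def[symmetric]
    by (intro det_eq_prod_eigenvalues[OF M cube_char_mat_carrier det_cube_char_mat_nonzero])
  also have "\<dots> = (\<Prod>X\<in>Pow {..<n}. F (card X))"
    unfolding S_def by (rule prod.reindex_bij_betw[OF bij_betw_cube_subset])
  \<comment> \<open>One factor \<open>n\<close> comes out for each of the 2^n subsets.\<close>
  also have "\<dots> = smult (real n ^ (2 ^ n)) (\<Prod>X\<in>Pow {..<n}. [:- (2 * real (card X) / real n), 1:])"
    unfolding F_def prod_smult by (simp add: card_Pow)
  also have "(\<Prod>X\<in>Pow {..<n}. [:- (2 * real (card X) / real n), 1:]) =
      (\<Prod>k = 0..n. [:- (2 * real k / real n), 1:] ^ (n choose k))"
    using prod_Pow_card[of "{..<n}" "\<lambda>k. [:- (2 * real k / real n), 1:]"] by simp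
  finally show ?thesis .
qed

end
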